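(* Let $j,N$ be integers with $0<j<N$ and $\gcd(j,N)=1$, put $\theta=j\pi/N$ and $\kappa=2\cos\theta$, and let $r$ be a positive real root of $$(\kappa^3-2\kappa)\,r^3+3(1-\kappa^2)\,r^2+3\kappa r-1=0 .$$ Put $$S=3-\kappa r,\qquad P=3-r^2-3\kappa r+\kappa^2r^2,$$ assume $P\neq 0$, and put $$z=\frac{1}{P r^2},\qquad a=\tfrac12\big(S+\sqrt{S^2-4P}\big),\qquad b=\tfrac12\big(S-\sqrt{S^2-4P}\big).$$ Suppose that $S^2-4P>0$ and $|z|<256/27$. Then $z<0$, $a>0>b$, and $$r=\frac{\sin\big(\tfrac{\pi+\theta}{3}\big)}{\sin\big(\tfrac{\pi+4\theta}{3}\big)} .$$ The roots of $x^4-3x^3+3x^2-x+\tfrac1z=0$ are $a$, $b$ and $re^{\pm i\theta}$, and $$-\frac{z}{4}\;{}_5F_4\!\left(\begin{matrix}1,1,1,\tfrac43,\tfrac53\\ \tfrac54,\tfrac32,\tfrac74,2\end{matrix}\;\middle|\;\frac{27z}{256}\right) = -\frac13\Big(1-\frac{2j}{N}\Big)^2\pi^2+\tfrac12\ln^2 a+\tfrac12\ln^2|b|+\tfrac23\ln^2 r-\tfrac13\ln a\,\ln|b|-\tfrac23\ln r\,(\ln a+\ln|b|).$$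
   Context: Here ${}_5F_4\left(\begin{matrix}a_1,\dots,a_5\\ b_1,\dots,b_4\end{matrix}\middle|w\right)=\sum_{m\ge0}\frac{(a_1)_m\cdots(a_5)_m}{(b_1)_m\cdots(b_4)_m}\frac{w^m}{m!}$ is the generalized hypergeometric series, with $(a)_m=a(a+1)\cdots(a+m-1)$; it converges for $|w|<1$. All logarithms in the formula are real logarithms of positive reals, and $\ln^2 x$ means $(\ln x)^2$. *)

theory Defs
  imports "HOL-Analysis.Analysis" "HOL-Computational_Algebra.Computational_Algebra"
begin

text \<open>
  The value at \<open>w\<close> of the generalized hypergeometric series with upper parameters \<open>as\<close> and
  lower parameters \<open>bs\<close>.  The third argument of \<^const>\<open>fps_hypergeo\<close> merely rescales the
  variable, so it is set to \<open>1\<close>.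
\<close>
definition hypergeo :: "real list \<Rightarrow> real list \<Rightarrow> real \<Rightarrow> real" where
  "hypergeo as bs w = eval_fps (fps_hypergeo as bs 1) w"

lemma hypergeo_altdef:
  "hypergeo as bs w =
     (\<Sum>m. prod_list (map (\<lambda>a. pochhammer a m) as) / prod_list (map (\<lambda>b. pochhammer b m) bs)
            * (w ^ m / fact m))"
proof -
  have foldl_eq: "foldl (\<lambda>r a. r * pochhammer a m) c xs = c * prod_list (map (\<lambda>a. pochhammer a m) xs)"
    for c :: real and m xs
    by (induction xs arbitrary: c) (simp_all add: mult.assoc)
  show ?thesis
    by (simp add: hypergeo_def eval_fps_def foldl_eq)
qed

end

theory Submission
  imports Defs "HOL-Complex_Analysis.Cauchy_Integral_Theorem"
begin

text \<open>
  The equation \<open>x\<^sup>4 - 3 x\<^sup>3 + 3 x\<^sup>2 - x + 1/z = 0\<close> says \<open>z x (1 - x)\<^sup>3 = 1\<close>.  The cubic condition on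
  \<open>r\<close> makes \<open>r e\<^bsup>\<plusminus>i\<theta>\<^esup>\<close> two of its roots, and \<open>a\<close>, \<open>b\<close> are the roots of the complementary quadratic factor.
  A positive \<open>z\<close> below \<open>256/27\<close> would leave no real root, because \<open>x (1 - x)\<^sup>3 \<le> 27/256\<close> with equality at
  \<open>x = 1/4\<close>; hence \<open>z < 0\<close>.  The formula comes from two evaluations of one integral.

  \<^item> The \<open>m\<close>-th term of the series times \<open>z/4\<close> is \<open>z\<^sup>n / n \<cdot> B(n, 3n+1)\<close> with \<open>n = m + 1\<close>, and
    \<open>B(n, 3n+1)\<close> is the integral of \<open>x\<^sup>n\<^sup>-\<^sup>1 (1 - x)\<^sup>3\<^sup>n\<close> over the unit interval.  Summing under the
    integral sign yields a logarithm (\<open>has_integral_hypergeo\<close>):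
    \<open>z/4 \<cdot> F = - \<integral> ln (1 - z x (1 - x)\<^sup>3) / x dx\<close>.  The same bound
    on \<open>x (1 - x)\<^sup>3\<close> makes the convergence uniform.

  \<^item> The product of the roots is \<open>1/z\<close>, so \<open>1 - z x (1 - x)\<^sup>3\<close> is the product of the factors
    \<open>1 - x / x\<^sub>i\<close>; the logarithm splits and the integral becomes the sum of the dilogarithms
    \<open>Li\<^sub>2 (1 / x\<^sub>i)\<close> (\<open>has_integral_dilog_sum\<close>).

  It remains to see that this sum of dilogarithms is elementary.  Consider the roots as functions of a
  parameter.  The derivative of \<open>Li\<^sub>2 (1/x)\<close> is \<open>ln (1 - 1/x) \<cdot> x'/x\<close>, and the equation gives
  \<open>ln (1 - 1/x) = (\<Lambda> - 4 ln x) / 3\<close>, where \<open>\<Lambda> = ln (-1/z)\<close> is also the sum of the logarithms of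
  the moduli of the roots; here \<open>ln x\<close> stands for \<open>ln \<bar>x\<bar>\<close> at a real root and for
  \<open>ln r \<plusminus> i (\<theta> - \<pi>/2)\<close> at the nonreal ones.  Each derivative is therefore a
  polynomial in logarithms and their derivatives, and the sum is the derivative of \<open>\<Lambda>\<^sup>2/6 - 2/3 \<Sum> (ln x\<^sub>i)\<^sup>2\<close> (\<open>dilog_sum_deriv\<close>).  A good parameter is
  the argument \<open>\<theta>\<close> of the root in the upper half-plane: the triangle with vertices \<open>0\<close>, \<open>1\<close> and that root
  has the angles \<open>\<theta>\<close>, \<open>(\<pi> + \<theta>)/3\<close> and \<open>(2\<pi> - 4\<theta>)/3\<close>, so the law of sines gives its modulus as an
  explicit function of \<open>\<theta>\<close>, and the real roots then solve an explicit quadratic equation.  As \<open>\<theta>\<close> grows to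
  \<open>\<pi>/2\<close>, the root moduli tend to infinity with ratios tending to \<open>1\<close>.  The dilogarithms vanish in the
  limit, and so does the logarithmic expression, whose quadratic form is degenerate in the direction of equal
  logarithms; this fixes the constant of integration (\<open>dilog_sum_limit\<close>).
\<close>

section \<open>The dilogarithm on the slit plane\<close>

text \<open>
  The value at \<open>0\<close> removes the singularity of \<open>- Ln (1 - w) / w\<close>.
\<close>
definition dilog_deriv :: "complex \<Rightarrow> complex" where
  "dilog_deriv w = (if w = 0 then 1 else - Ln (1 - w) / w)"

definition dilog_domain :: "complex set" where
  "dilog_domain = {w. 1 - w \<notin> \<real>\<^sub>\<le>\<^sub>0}"

text \<open>
  The plane cut along the real half-line from \<open>1\<close> is star-shaped about \<open>0\<close>, and Cauchy's theorem there allows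
  a finite set of points at which the integrand is merely continuous.  The removable singularity at
  \<open>0\<close> therefore needs only a limit, which is the difference quotient of \<open>- Ln (1 - w)\<close> at \<open>0\<close>.
\<close>
lemma dilog_primitive_exists:
  "\<exists>g. g 0 = 0 \<and> (\<forall>w\<in>dilog_domain. (g has_field_derivative dilog_deriv w) (at w))"
proof -
  have op: "open dilog_domain"
  proof -
    have "dilog_domain = (\<lambda>w. 1 - w) -` (- \<real>\<^sub>\<le>\<^sub>0)"
      by (auto simp: dilog_domain_def)
    also have "open \<dots>"
      by (intro open_vimage continuous_intros) (auto simp: open_Compl)
    finally show ?thesis .
  qed
  have star: "starlike dilog_domain"
    unfolding starlike_def
  proof (intro bexI ballI subsetI)
    fix w v assume w: "w \<in> dilog_domain" and "v \<in> closed_segment 0 w"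
    then obtain t where t: "0 \<le> t" "t \<le> 1" "v = of_real t * w"
      by (auto simp: in_segment scaleR_conv_of_real)
    show "v \<in> dilog_domain"
    proof (rule ccontr)
      assume "v \<notin> dilog_domain"
      hence v: "1 \<le> t * Re w" "t * Im w = 0"
        by (auto simp: dilog_domain_def complex_nonpos_Reals_iff t)
      hence "t \<noteq> 0" by auto
      moreover have "0 < t * Re w" using v(1) by linarith
      hence "0 < Re w" using t(1) by (auto simp: zero_less_mult_iff)
      hence "t * Re w \<le> Re w" using t by (simp add: mult_left_le_one_le)
      ultimately show False
        using w v by (auto simp: dilog_domain_def complex_nonpos_Reals_iff)
    qed
  qed (auto simp: dilog_domain_def)
  have diff: "dilog_deriv field_differentiable at w" if w: "w \<in> dilog_domain - {0}" for w
  proof -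
    have "(\<lambda>w. - Ln (1 - w) / w) field_differentiable at w"
    proof -
      have "((\<lambda>w. - Ln (1 - w) / w) has_field_derivative
               (1 / (1 - w) * w + Ln (1 - w)) / (w * w)) (at w)"
        using w by (auto intro!: derivative_eq_intros simp: dilog_domain_def field_simps)
      thus ?thesis by (auto simp: field_differentiable_def)
    qed
    moreover have "eventually (\<lambda>v. v \<in> - {0}) (nhds w)"
      using w by (intro eventually_nhds_in_open) auto
    hence "eventually (\<lambda>v. - Ln (1 - v) / v = dilog_deriv v) (nhds w)"
      by eventually_elim (auto simp: dilog_deriv_def)
    ultimately show ?thesis
      unfolding field_differentiable_def
      using DERIV_cong_ev[OF refl _ refl] by fast
  qed
  have "((\<lambda>w. - Ln (1 - w)) has_field_derivative 1) (at 0)"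
    by (auto intro!: derivative_eq_intros)
  hence "((\<lambda>w. - Ln (1 - w) / w) \<longlongrightarrow> 1) (at 0)"
    by (simp add: has_field_derivative_iff)
  hence "(dilog_deriv \<longlongrightarrow> 1) (at 0)"
    by (rule Lim_transform_eventually) (auto simp: dilog_deriv_def eventually_at_filter)
  hence cont0: "isCont dilog_deriv 0"
    by (simp add: isCont_def dilog_deriv_def)
  have "continuous_on dilog_domain dilog_deriv"
    using diff cont0 by (intro continuous_at_imp_continuous_on ballI)
      (metis DiffI field_differentiable_imp_continuous_at singletonD)
  from holomorphic_starlike_primitive[OF this star op, of "{0}"] diff
  obtain g where g: "\<forall>x\<in>dilog_domain. (g has_field_derivative dilog_deriv x) (at x)"
    by auto
  hence "\<forall>x\<in>dilog_domain. ((\<lambda>x. g x - g 0) has_field_derivative dilog_deriv x) (at x)"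
    by (auto intro!: derivative_eq_intros)
  thus ?thesis by (intro exI[of _ "\<lambda>x. g x - g 0"]) auto
qed

definition dilog :: "complex \<Rightarrow> complex" where
  "dilog = (SOME g. g 0 = 0 \<and> (\<forall>w\<in>dilog_domain. (g has_field_derivative dilog_deriv w) (at w)))"

lemma dilog_0 [simp]: "dilog 0 = 0"
  and has_field_derivative_dilog:
    "w \<in> dilog_domain \<Longrightarrow> (dilog has_field_derivative dilog_deriv w) (at w)"
  using someI_ex[OF dilog_primitive_exists] unfolding dilog_def by blast+

lemma isCont_dilog: "w \<in> dilog_domain \<Longrightarrow> isCont dilog w"
  by (rule DERIV_isCont[OF has_field_derivative_dilog])

lemma has_real_derivative_Re_dilog:
  assumes "(g has_vector_derivative g') (at x)" and "g x \<in> dilog_domain"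
  shows "((\<lambda>t. Re (dilog (g t))) has_real_derivative Re (g' * dilog_deriv (g x))) (at x)"
  using bounded_linear.has_vector_derivative[OF bounded_linear_Re
      field_vector_diff_chain_at[OF assms(1) has_field_derivative_dilog[OF assms(2)]]]
  by (simp add: has_real_derivative_iff_has_vector_derivative o_def)

text \<open>
  On a ray through the origin the real part of the dilogarithm has a derivative that involves only
  the modulus of \<open>1 - x / c\<close>.  No choice of branch survives, so these derivatives can be added
  over the roots of a polynomial to give the logarithm of the polynomial itself.
\<close>
lemma has_real_derivative_Re_dilog_ray:
  assumes "c \<noteq> 0" and "x \<noteq> 0" and "of_real x / c \<in> dilog_domain"
  shows "((\<lambda>t. Re (dilog (of_real t / c))) has_real_derivative
            - ln (cmod (1 - of_real x / c)) / x) (at x)"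
proof -
  have "((\<lambda>t. of_real t / c) has_vector_derivative 1 / c) (at x)"
    unfolding has_vector_derivative_def
    by (rule derivative_eq_intros refl assms(1))+ (simp add: scaleR_conv_of_real)
  from has_real_derivative_Re_dilog[OF this assms(3)]
  have "((\<lambda>t. Re (dilog (of_real t / c))) has_real_derivative
           Re (1 / c * dilog_deriv (of_real x / c))) (at x)" .
  moreover have "1 - of_real x / c \<noteq> 0"
    using assms(3) by (auto simp: dilog_domain_def)
  hence "Re (1 / c * dilog_deriv (of_real x / c)) = - ln (cmod (1 - of_real x / c)) / x"
    using assms by (simp add: dilog_deriv_def Re_divide_of_real flip: Re_Ln)
  ultimately show ?thesis by metis
qed

text \<open>
  Motion of a single root: this is \<open>d Li\<^sub>2 (1/c) = Ln (1 - 1/c) d(Ln c)\<close>.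
\<close>
lemma has_real_derivative_Re_dilog_inverse:
  assumes c: "(c has_vector_derivative c') (at x)" and "c x \<noteq> 0" and "1 / c x \<in> dilog_domain"
  shows "((\<lambda>t. Re (dilog (1 / c t))) has_real_derivative
            Re (Ln (1 - 1 / c x) * (c' / c x))) (at x)"
proof -
  have "((\<lambda>w. 1 / w) has_field_derivative - 1 / (c x)\<^sup>2) (at (c x))"
    using assms by (auto intro!: derivative_eq_intros simp: power2_eq_square)
  from field_vector_diff_chain_at[OF c this]
  have "((\<lambda>t. 1 / c t) has_vector_derivative c' * (- 1 / (c x)\<^sup>2)) (at x)"
    by (simp add: o_def)
  from has_real_derivative_Re_dilog[OF this assms(3)]
  show ?thesis using assms(2) by (simp add: dilog_deriv_def power2_eq_square mult.commute)
qed

section \<open>The hypergeometric series as an integral\<close>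

text \<open>
  The maximum is attained at \<open>x = 1/4\<close>, so \<open>(x - 1/4)\<^sup>2\<close> divides the difference; the other
  quadratic factor is positive.
\<close>
lemma quartic_le:
  fixes x :: real
  shows "x * (1 - x)^3 \<le> 27 / 256"
proof -
  have "27 / 256 - x * (1 - x)^3 = (x - 1/4)^2 * ((x - 5/4)^2 + 1/8)"
    by (simp add: power2_eq_square power3_eq_cube field_simps)
  also have "\<dots> \<ge> 0" by simp
  finally show ?thesis by simp
qed

lemma has_integral_monomial_Beta:
  "((\<lambda>x::real. x^m * (1 - x)^n) has_integral (fact m * fact n / fact (m + n + 1))) {0..1}"
proof -
  have "((\<lambda>t::real. t powr (real m + 1 - 1) * (1 - t) powr (real n + 1 - 1)) has_integral
           Beta (real m + 1) (real n + 1)) {0..1}"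
    by (rule has_integral_Beta_real) auto
  also have "Beta (real m + 1) (real n + 1) = fact m * fact n / fact (m + n + 1)"
    using Gamma_fact[of m, where ?'a = real] Gamma_fact[of n, where ?'a = real]
      Gamma_fact[of "m + n + 1", where ?'a = real]
    by (simp add: Beta_def add_ac)
  finally show ?thesis
    by (rule has_integral_spike_finite[where S = "{0, 1}", rotated 2]) (auto simp: powr_realpow)
qed

text \<open>
  Both sides have the same term ratio in \<open>m\<close>: the parameters \<open>4/3\<close>, \<open>5/3\<close> and \<open>5/4\<close>, \<open>3/2\<close>,
  \<open>7/4\<close>, \<open>2\<close> account for the new factors of \<open>(3m + 3)!\<close> and \<open>(4m + 4)!\<close>, up to the powers of \<open>3\<close> and \<open>4\<close>
  that \<open>27/256\<close> supplies.
\<close>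
lemma hypergeo_coeff:
  fixes m :: nat
  defines "as \<equiv> [1, 1, 1, 4/3, 5/3 :: real]" and "bs \<equiv> [5/4, 3/2, 7/4, 2 :: real]"
  shows "prod_list (map (\<lambda>a. pochhammer a m) as) / prod_list (map (\<lambda>b. pochhammer b m) bs)
           * ((27 / 256) ^ m / fact m)
         = 4 / (real m + 1) * (fact m * fact (3 * m + 3) / fact (4 * m + 4))"
proof (induction m)
  case 0
  show ?case by (simp add: as_def bs_def fact_numeral)
next
  case (Suc m)
  define p :: real where "p = 27 / 256"
  define L R where "L = (\<lambda>m. prod_list (map (\<lambda>a. pochhammer a m) as) /
      prod_list (map (\<lambda>b. pochhammer b m) bs) * (p ^ m / fact m))"
    and "R = (\<lambda>m. 4 / (real m + 1) * (fact m * fact (3 * m + 3) / fact (4 * m + 4) :: real))"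
  define q where "q = (1 + real m)^3 * (4/3 + m) * (5/3 + m) /
      ((5/4 + m) * (3/2 + m) * (7/4 + m) * (2 + m)) * p / (1 + real m)"
  have "L (Suc m) = L m * q"
    by (simp add: L_def q_def as_def bs_def pochhammer_Suc power3_eq_cube mult_ac)
  also have "L m = R m" using Suc by (simp add: L_def R_def p_def)
  also have "R m * q = R (Suc m)"
  proof -
    have e3: "fact (3 * Suc m + 3) = (3 * real m + 6) * ((3 * real m + 5) * ((3 * real m + 4) * fact (3 * m + 3)))"
      by (simp add: algebra_simps eval_nat_numeral flip: fact_Suc)
        (simp add: algebra_simps)
    have e4: "fact (4 * Suc m + 4) = (4 * real m + 8) * ((4 * real m + 7) * ((4 * real m + 6) * ((4 * real m + 5) * fact (4 * m + 4))))"
      by (simp add: algebra_simps eval_nat_numeral flip: fact_Suc)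
        (simp add: algebra_simps)
    have q: "q = (real m + 1) * (real m + 1) * (3 * real m + 4) * (3 * real m + 5) * 3 /
      ((4 * real m + 5) * (4 * real m + 6) * (4 * real m + 7) * 4 * (real m + 2))"
      by (simp add: q_def p_def divide_simps power3_eq_cube) (simp add: algebra_simps)
    define F G f where "F = (fact (3 * m + 3) :: real)" "G = (fact (4 * m + 4) :: real)" "f = (fact m :: real)"
    have "G > 0" by (simp add: F_G_f_def)
    show ?thesis unfolding R_def e3 e4 q fact_Suc of_nat_Suc F_G_f_def[symmetric]
      using \<open>G > 0\<close> by (simp add: divide_simps) (simp add: algebra_simps)
  qed
  finally show ?case by (simp only: L_def R_def p_def)
qed

text \<open>
  The series of \<open>- ln (1 - u) / x\<close> at \<open>u = z x (1 - x)\<^sup>3\<close> converges uniformly on the unit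
  interval, since \<open>\<bar>u\<bar> \<le> 27/256 \<bar>z\<bar> < 1\<close> there, and its terms integrate to Beta values.
\<close>
lemma has_integral_hypergeo:
  fixes z :: real
  assumes z: "\<bar>z\<bar> < 256 / 27"
  shows "((\<lambda>x. - ln (1 - z * (x * (1 - x)^3)) / x) has_integral
            z / 4 * hypergeo [1, 1, 1, 4/3, 5/3] [5/4, 3/2, 7/4, 2] (27 * z / 256)) {0..1}"
proof -
  define f where "f = (\<lambda>n x::real. z ^ Suc n * (x ^ n * (1 - x)^(3 * n + 3)) / real (Suc n))"
  define q where "q = \<bar>z\<bar> * (27 / 256)"
  define I where "I = (\<lambda>n. z ^ Suc n / real (Suc n) *
      (fact n * fact (3 * n + 3) / fact (4 * n + 4)))"
  have q: "0 \<le> q" "q < 1" using z by (auto simp: q_def)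
  have small: "\<bar>z * (x * (1 - x)^3)\<bar> \<le> q" if "x \<in> {0..1}" for x :: real
    unfolding q_def abs_mult using that quartic_le[of x] by (intro mult_left_mono) auto
  have f_altdef: "f n x = (z * (1 - x)^3) * (z * (x * (1 - x)^3)) ^ n / real (Suc n)" for n x
    by (simp add: f_def power_mult_distrib power_add mult_ac flip: power_mult)
  have "uniform_limit {0..1} (\<lambda>n x. \<Sum>i<n. f i x) (\<lambda>x. suminf (\<lambda>i. f i x)) sequentially"
  proof (rule Weierstrass_m_test)
    fix n and x :: real assume x: "x \<in> {0..1}"
    have "norm (f n x) = \<bar>z\<bar> * (1 - x)^3 * \<bar>z * (x * (1 - x)^3)\<bar> ^ n / real (Suc n)"
      using x by (simp add: f_altdef abs_mult power_abs)
    also have "\<dots> \<le> \<bar>z\<bar> * 1 * q ^ n / 1"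
      using x small[OF x] q
      by (intro frac_le mult_mono power_mono mult_nonneg_nonneg) (auto intro: power_le_one)
    finally show "norm (f n x) \<le> \<bar>z\<bar> * q ^ n" by simp
  next
    show "summable (\<lambda>n. \<bar>z\<bar> * q ^ n)"
      using q by (intro summable_mult summable_geometric) auto
  qed
  then obtain J K where J: "\<And>n. ((\<lambda>x. \<Sum>i<n. f i x) has_integral J n) {0..1}"
    and K: "((\<lambda>x. suminf (\<lambda>i. f i x)) has_integral K) {0..1}" and JK: "J \<longlonglongrightarrow> K"
    by (rule uniform_limit_integral) (auto intro!: continuous_intros simp: f_def)
  have fI: "(f n has_integral I n) {0..1}" for n
    using has_integral_mult_right[OF has_integral_monomial_Beta[of n "3 * n + 3"],
        of "z ^ Suc n / real (Suc n)"]
    by (simp add: f_def I_def add_ac)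
  have "J = (\<lambda>n. \<Sum>i<n. I i)"
    using has_integral_unique[OF J has_integral_sum[OF _ fI]] by fast
  with JK have "I sums K" by (simp add: sums_def)
  moreover have "I sums (z / 4 * hypergeo [1, 1, 1, 4/3, 5/3] [5/4, 3/2, 7/4, 2] (27 * z / 256))"
  proof -
    define t where "t = (\<lambda>m. prod_list (map (\<lambda>a. pochhammer a m) [1, 1, 1, 4/3, 5/3]) /
       prod_list (map (\<lambda>b. pochhammer b m) [5/4, 3/2, 7/4, 2 :: real])
            * ((27 * z / 256) ^ m / fact m))"
    have It: "I m = z / 4 * t m" for m
    proof -
      have "t m = z ^ m * (4 / (real m + 1) * (fact m * fact (3 * m + 3) / fact (4 * m + 4)))"
        unfolding hypergeo_coeff[symmetric] t_def
        by (simp add: power_mult_distrib power_divide)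
      thus ?thesis by (simp add: I_def add_ac)
    qed
    have "summable t"
    proof (cases "z = 0")
      case True
      thus ?thesis by (intro summable_finite[of "{0}"]) (auto simp: t_def)
    next
      case False
      have "summable (\<lambda>m. z / 4 * t m)"
        using sums_summable[OF \<open>I sums K\<close>] by (simp only: flip: It)
      thus ?thesis using False by (simp only: summable_cmult_iff) auto
    qed
    hence "t sums hypergeo [1, 1, 1, 4/3, 5/3] [5/4, 3/2, 7/4, 2] (27 * z / 256)"
      unfolding hypergeo_altdef t_def by (rule summable_sums)
    from sums_mult[OF this, of "z / 4"] show ?thesis by (simp only: flip: It)
  qed
  ultimately have "K = z / 4 * hypergeo [1, 1, 1, 4/3, 5/3] [5/4, 3/2, 7/4, 2] (27 * z / 256)"
    by (rule sums_unique2)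
  with K have "((\<lambda>x. suminf (\<lambda>i. f i x)) has_integral
      z / 4 * hypergeo [1, 1, 1, 4/3, 5/3] [5/4, 3/2, 7/4, 2] (27 * z / 256)) {0..1}"
    by simp
  thus ?thesis
  proof (rule has_integral_spike_finite[where S = "{0}", rotated 2])
    fix x :: real assume x: "x \<in> {0..1} - {0}"
    define u where "u = z * (x * (1 - x)^3)"
    have u: "\<bar>u\<bar> < 1" using small[of x] x q by (auto simp: u_def)
    have "(\<lambda>n. - (u ^ n) / real n) sums ln (1 - u)"
      using ln_series'[of "-u"] u by simp
    hence "(\<lambda>n. - (u ^ Suc n) / real (Suc n)) sums ln (1 - u)"
      by (subst sums_Suc_iff) simp
    from sums_mult[OF this, of "- 1 / x"]
    have "(\<lambda>n. - 1 / x * (- (u ^ Suc n) / real (Suc n))) sums (- ln (1 - u) / x)" by simp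
    moreover have "- 1 / x * (- (u ^ Suc n) / real (Suc n)) = f n x" for n
      using x by (simp add: f_altdef flip: u_def) (simp add: u_def)
    ultimately show "- ln (1 - z * (x * (1 - x) ^ 3)) / x = suminf (\<lambda>i. f i x)"
      by (simp add: sums_iff u_def)
  qed auto
qed

section \<open>The roots of the quartic as functions of an argument\<close>

text \<open>
  Division of the quartic by the real quadratic with the roots \<open>r e\<^bsup>\<plusminus>i\<theta>\<^esup>\<close>, where \<open>\<kappa> = 2 cos \<theta>\<close>.
  The linear coefficient of the remainder is a cubic in \<open>r\<close>; it vanishes exactly when the quadratic
  splits off from \<open>x (x - 1)\<^sup>3 + r\<^sup>2 P\<close>.  The identity is needed over the reals and over the complex numbers.
\<close>
lemma quartic_identity:
  fixes \<kappa> r x :: "'a :: comm_ring_1"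
  defines "S \<equiv> 3 - \<kappa> * r" and "P \<equiv> 3 - r^2 - 3 * \<kappa> * r + \<kappa>^2 * r^2"
  shows "x * (x - 1)^3 = (x^2 - \<kappa> * r * x + r^2) * (x^2 - S * x + P)
           + ((\<kappa>^3 - 2 * \<kappa>) * r^3 + 3 * (1 - \<kappa>^2) * r^2 + 3 * \<kappa> * r - 1) * x - r^2 * P"
  unfolding S_def P_def by (simp add: algebra_simps power2_eq_square power3_eq_cube)

lemma rcis_quadratic_zero:
  "(rcis r \<theta>)^2 - of_real (2 * cos \<theta>) * of_real r * rcis r \<theta> + (of_real r)^2 = 0"
proof (rule complex_eqI)
  have "(r * cos \<theta>)^2 - (r * sin \<theta>)^2 - 2 * cos \<theta> * r * (r * cos \<theta>) + r^2 = 0"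
    using sin_cos_squared_add[of \<theta>] by algebra
  thus "Re ((rcis r \<theta>)^2 - of_real (2 * cos \<theta>) * of_real r * rcis r \<theta> + (of_real r)^2) = Re 0"
    by (simp add: Re_power2)
qed (simp add: Im_power2)

text \<open>
  By the law of sines this is the distance from \<open>0\<close> to \<open>c\<close> in a triangle with vertices \<open>0\<close>, \<open>1\<close>, \<open>c\<close> whose angles
  at \<open>0\<close> and \<open>1\<close> are \<open>\<theta>\<close> and \<open>(\<pi> + \<theta>)/3\<close>.
\<close>
definition root_modulus :: "real \<Rightarrow> real" where
  "root_modulus \<theta> = sin ((pi + \<theta>) / 3) / sin ((pi + 4 * \<theta>) / 3)"

text \<open>
  With \<open>c = r e\<^bsup>i\<theta>\<^esup>\<close> in the upper half-plane, the argument \<open>\<eta>\<close> of \<open>c - 1\<close> lies between \<open>\<theta>\<close> and \<open>\<pi>\<close>.  Positivity of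
  \<open>c (c - 1)\<^sup>3\<close> makes \<open>\<theta> + 3\<eta>\<close> a multiple of \<open>2\<pi>\<close> in the open interval from \<open>0\<close> to \<open>4\<pi>\<close>,
  hence equal to \<open>2\<pi>\<close>.  All angles of the triangle \<open>0\<close>, \<open>1\<close>, \<open>c\<close> are then known.
\<close>
lemma upper_root_forced:
  assumes \<theta>: "0 < \<theta>" "\<theta> < pi" and r: "r > 0"
    and q: "q > 0" "rcis r \<theta> * (rcis r \<theta> - 1)^3 = of_real q"
  shows "\<theta> < pi / 2" and "r = root_modulus \<theta>"
proof -
  define c where "c = rcis r \<theta>"
  define w where "w = 1 - 1 / c"
  define \<psi> where "\<psi> = Arg w"
  define \<rho> where "\<rho> = cmod w"
  have c0: "c \<noteq> 0" using r by (simp add: c_def)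
  have "1 / c = rcis (1 / r) (-\<theta>)"
    by (simp add: c_def rcis_inverse[symmetric] inverse_eq_divide)
  hence "Im w = sin \<theta> / r"
    by (simp add: w_def rcis_def)
  hence Imw: "Im w > 0" using \<theta> r by (simp add: sin_gt_zero)
  hence \<psi>: "0 < \<psi>" "\<psi> < pi" using Arg_lt_pi[of w] by (auto simp: \<psi>_def)
  have w: "w = rcis \<rho> \<psi>" unfolding \<rho>_def \<psi>_def by (rule rcis_cmod_Arg[symmetric])
  have \<rho>: "\<rho> > 0" using Imw by (auto simp: \<rho>_def)
  define \<eta> where "\<eta> = \<theta> + \<psi>"
  have "c - 1 = c * w" using c0 by (simp add: w_def field_simps)
  hence c1: "c - 1 = rcis (r * \<rho>) \<eta>" by (simp add: w c_def rcis_mult \<eta>_def)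
  have "r * sin \<theta> = Im (c - 1)" by (simp add: c_def)
  also have "\<dots> = r * \<rho> * sin \<eta>" by (simp add: c1)
  finally have im: "sin \<theta> = \<rho> * sin \<eta>" using r by simp
  have re: "r * cos \<theta> - 1 = r * \<rho> * cos \<eta>"
    using arg_cong[OF c1, of Re] by (simp add: c_def)
  have "\<rho> * sin \<eta> > 0" using im \<theta> by (simp add: sin_gt_zero flip: im)
  hence "sin \<eta> > 0" using \<rho> by (simp add: zero_less_mult_iff)
  hence \<eta>pi: "\<eta> < pi" using \<theta> \<psi> sin_le_zero[of \<eta>] by (force simp: \<eta>_def)
  define A where "A = \<theta> + 3 * \<eta>"
  have "of_real q = rcis (r * (r * \<rho>)^3) A"
    using q(2) c1 by (simp add: c_def DeMoivre2 rcis_mult A_def)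
  from this[symmetric] have "r * (r * \<rho>)^3 * cos A = q" "sin A = 0"
    using r \<rho> by (auto simp: complex_eq_iff)
  hence "cos A > 0" "sin A = 0" using q r \<rho>
    by (metis mult_pos_pos zero_less_mult_pos zero_less_power, simp)
  hence "cos A = 1" using sin_cos_squared_add[of A] by (simp add: power2_eq_1_iff)
  then obtain n :: int where n: "A = real_of_int n * (2 * pi)"
    using cos_one_2pi_int by (metis mult.assoc)
  have "0 < A" "A < 4 * pi" using \<theta> \<psi> \<eta>pi by (auto simp: A_def \<eta>_def)
  hence "0 < real_of_int n" "real_of_int n < 2" unfolding n
    by (simp_all add: zero_less_mult_iff)
  hence "n = 1" by linarith
  hence A: "\<theta> + 3 * \<eta> = 2 * pi" using n by (simp add: A_def)
  show "\<theta> < pi / 2" using A \<psi> by (simp add: \<eta>_def)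
  \<comment> \<open>The law of sines, read off from the real and imaginary parts of \<open>c - 1\<close>.\<close>
  have "r * sin (\<eta> - \<theta>) = r * cos \<theta> * sin \<eta> - cos \<eta> * (r * sin \<theta>)"
    by (simp add: sin_diff algebra_simps)
  also have "\<dots> = (r * cos \<theta> - r * \<rho> * cos \<eta>) * sin \<eta>"
    unfolding im by (simp add: algebra_simps)
  also have "\<dots> = sin \<eta>" using re by (simp add: algebra_simps flip: re)
  finally have eq: "r * sin (\<eta> - \<theta>) = sin \<eta>" .
  have "(pi + \<theta>) / 3 = pi - \<eta>" "(pi + 4 * \<theta>) / 3 = pi - (\<eta> - \<theta>)" using A by simp_all
  hence "root_modulus \<theta> = sin \<eta> / sin (\<eta> - \<theta>)" unfolding root_modulus_def by (simp only: sin_pi_minus)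
  moreover have "sin (\<eta> - \<theta>) > 0" using \<psi> by (simp add: \<eta>_def sin_gt_zero)
  ultimately show "r = root_modulus \<theta>"
    using eq by (metis less_irrefl mult_right_cancel nonzero_eq_divide_eq)
qed

text \<open>
  Sum and product of the two real roots, as the division of the quartic by
  \<open>x\<^sup>2 - 2 r cos \<theta> x + r\<^sup>2\<close> gives them.
\<close>
definition real_root_sum :: "real \<Rightarrow> real" where
  "real_root_sum \<theta> = 3 - 2 * cos \<theta> * root_modulus \<theta>"
definition real_root_prod :: "real \<Rightarrow> real" where
  "real_root_prod \<theta> = 3 - (root_modulus \<theta>)^2 - 3 * (2 * cos \<theta>) * root_modulus \<theta> + (2 * cos \<theta>)^2 * (root_modulus \<theta>)^2"
definition pos_root :: "real \<Rightarrow> real" where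
  "pos_root \<theta> = 1 / 2 * (real_root_sum \<theta> + sqrt ((real_root_sum \<theta>)^2 - 4 * real_root_prod \<theta>))"
definition neg_root :: "real \<Rightarrow> real" where
  "neg_root \<theta> = 1 / 2 * (real_root_sum \<theta> - sqrt ((real_root_sum \<theta>)^2 - 4 * real_root_prod \<theta>))"

lemma Ln_rcis: "\<rho> > 0 \<Longrightarrow> -pi < \<phi> \<Longrightarrow> \<phi> \<le> pi \<Longrightarrow> Ln (rcis \<rho> \<phi>) = Complex (ln \<rho>) \<phi>"
  by (rule Ln_unique) (auto simp: Complex_eq rcis_def exp_add cis_conv_exp exp_of_real)

lemma real_quadratic_roots:
  fixes S P :: real
  assumes "P < 0"
  defines "a \<equiv> 1 / 2 * (S + sqrt (S^2 - 4 * P))" and "b \<equiv> 1 / 2 * (S - sqrt (S^2 - 4 * P))"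
  shows "a + b = S" "a * b = P" "b < 0" "0 < a"
proof -
  have D: "S^2 - 4 * P > 0" using assms(1) by (smt (verit) zero_le_power2)
  show "a + b = S" by (simp add: a_def b_def field_simps)
  show "a * b = P"
  proof -
    have "a * b = (S^2 - (sqrt (S^2 - 4 * P))^2) / 4"
      by (simp add: a_def b_def power2_eq_square algebra_simps)
    thus ?thesis using D by simp
  qed
  with assms have "a * b < 0" by simp
  moreover have "b < a" using D by (simp add: a_def b_def)
  ultimately show "b < 0" "0 < a" by (auto simp: mult_less_0_iff)
qed

lemma root_modulus_pos: "0 < \<theta> \<Longrightarrow> \<theta> < pi / 2 \<Longrightarrow> root_modulus \<theta> > 0"
  by (auto simp: root_modulus_def intro!: divide_pos_pos sin_gt_zero)

text \<open>
  The converse of the previous angle computation: the prescribed modulus does place \<open>c - 1\<close> at the argument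
  \<open>(2\<pi> - \<theta>)/3\<close>, so that \<open>c (c - 1)\<^sup>3\<close> is positive.
\<close>
lemma upper_root_geometry:
  assumes \<theta>: "0 < \<theta>" "\<theta> < pi / 2"
  obtains \<rho> where "\<rho> > 0" "1 - 1 / rcis (root_modulus \<theta>) \<theta> = rcis \<rho> ((2 * pi - 4 * \<theta>) / 3)"
    "rcis (root_modulus \<theta>) \<theta> * (rcis (root_modulus \<theta>) \<theta> - 1)^3 = of_real ((root_modulus \<theta>)^4 * \<rho>^3)"
proof -
  define \<eta> where "\<eta> = (2 * pi - \<theta>) / 3"
  define r where "r = root_modulus \<theta>"
  define \<rho> where "\<rho> = sin \<theta> / sin \<eta>"
  have r0: "r > 0" unfolding r_def using \<theta> by (rule root_modulus_pos)
  have s: "sin \<eta> > 0" "sin \<theta> > 0" "sin (\<eta> - \<theta>) > 0"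
    using \<theta> by (auto simp: \<eta>_def field_simps intro!: sin_gt_zero)
  have "(pi + \<theta>) / 3 = pi - \<eta>" "(pi + 4 * \<theta>) / 3 = pi - (\<eta> - \<theta>)" by (simp_all add: \<eta>_def field_simps)
  hence r: "r = sin \<eta> / sin (\<eta> - \<theta>)" unfolding r_def root_modulus_def by (simp only: sin_pi_minus)
  have "rcis r \<theta> - 1 = rcis (r * \<rho>) \<eta>"
  proof (rule complex_eqI)
    have "r * \<rho> * cos \<eta> = sin \<theta> * cos \<eta> / sin (\<eta> - \<theta>)"
      using s by (simp add: r \<rho>_def)
    also have "sin \<theta> * cos \<eta> = sin \<eta> * cos \<theta> - sin (\<eta> - \<theta>)"
      by (simp add: sin_diff algebra_simps)
    also have "\<dots> / sin (\<eta> - \<theta>) = r * cos \<theta> - 1"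
      using s by (simp add: r field_simps)
    finally show "Re (rcis r \<theta> - 1) = Re (rcis (r * \<rho>) \<eta>)" by simp
    show "Im (rcis r \<theta> - 1) = Im (rcis (r * \<rho>) \<eta>)" using s by (simp add: \<rho>_def)
  qed
  note c1 = this
  show ?thesis
  proof (rule that[of \<rho>]; (fold r_def)?)
    show "\<rho> > 0" using s by (simp add: \<rho>_def)
    have "1 - 1 / rcis r \<theta> = (rcis r \<theta> - 1) / rcis r \<theta>"
      using r0 by (simp add: field_simps)
    also have "\<dots> = rcis \<rho> (\<eta> - \<theta>)" unfolding c1 using r0 by (simp add: rcis_divide)
    also have "\<eta> - \<theta> = (2 * pi - 4 * \<theta>) / 3" by (simp add: \<eta>_def field_simps)
    finally show "1 - 1 / rcis r \<theta> = rcis \<rho> ((2 * pi - 4 * \<theta>) / 3)" .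
    have "rcis r \<theta> * (rcis r \<theta> - 1)^3 = rcis (r * (r * \<rho>)^3) (\<theta> + 3 * \<eta>)"
      by (simp add: c1 DeMoivre2 rcis_mult)
    also have "\<theta> + 3 * \<eta> = 2 * pi" by (simp add: \<eta>_def field_simps)
    also have "r * (r * \<rho>)^3 = r^4 * \<rho>^3"
      by (simp add: power_mult_distrib flip: power_Suc)
    finally show "rcis r \<theta> * (rcis r \<theta> - 1)^3 = of_real (r^4 * \<rho>^3)"
      by (simp add: rcis_def)
  qed
qed

text \<open>
  All that the differentiation needs about the roots.  Taking logarithms in
  \<open>x (x - 1)\<^sup>3 = - r\<^sup>2 P\<close>, whose right-hand side has the logarithm \<open>\<Lambda>\<close>, expresses \<open>ln (1 - 1/x)\<close>
  through \<open>ln x\<close>.  For the nonreal root the branch of the logarithm is determined because the argument of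
  \<open>1 - 1/c\<close> is the angle \<open>(2\<pi> - 4\<theta>)/3\<close> of the triangle at \<open>c\<close>.
\<close>
lemma root_system:
  assumes \<theta>: "0 < \<theta>" "\<theta> < pi / 2"
  defines "a \<equiv> pos_root \<theta>" and "b \<equiv> neg_root \<theta>" and "r \<equiv> root_modulus \<theta>"
  defines "\<Lambda> \<equiv> ln a + ln (-b) + 2 * ln r"
  shows "1 < a" "b < 0" "real_root_prod \<theta> < 0" "a * b = real_root_prod \<theta>"
    and "\<And>x. x * (x - 1)^3 =
           (x^2 - 2 * cos \<theta> * r * x + r^2) * ((x - a) * (x - b)) - r^2 * real_root_prod \<theta>"
    and "ln (1 - 1 / a) = (\<Lambda> - 4 * ln a) / 3"
    and "ln (1 - 1 / b) = (\<Lambda> - 4 * ln (-b)) / 3"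
    and "1 / rcis r \<theta> \<in> dilog_domain"
    and "Ln (1 - 1 / rcis r \<theta>) = Complex ((\<Lambda> - 4 * ln r) / 3) ((2 * pi - 4 * \<theta>) / 3)"
proof -
  define P S where "P = real_root_prod \<theta>" and "S = real_root_sum \<theta>"
  define k where "k = ((2 * cos \<theta>)^3 - 2 * (2 * cos \<theta>)) * r^3 + 3 * (1 - (2 * cos \<theta>)^2) * r^2
      + 3 * (2 * cos \<theta>) * r - 1"
  have r0: "r > 0" unfolding r_def using \<theta> by (rule root_modulus_pos)
  from upper_root_geometry[OF \<theta>] obtain \<rho> where \<rho>: "\<rho> > 0"
    "1 - 1 / rcis r \<theta> = rcis \<rho> ((2 * pi - 4 * \<theta>) / 3)"
    "rcis r \<theta> * (rcis r \<theta> - 1)^3 = of_real (r^4 * \<rho>^3)"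
    unfolding r_def by blast
  have "of_real (r^4 * \<rho>^3) = of_real k * rcis r \<theta> - of_real (r^2 * P)"
    using quartic_identity[of "rcis r \<theta>" "of_real (2 * cos \<theta>)" "of_real r"]
      rcis_quadratic_zero[of r \<theta>] \<rho>(3)
    by (simp add: k_def P_def real_root_prod_def r_def)
  hence im: "k * (r * sin \<theta>) = 0" and re: "r^4 * \<rho>^3 = k * (r * cos \<theta>) - r^2 * P"
    by (auto simp: complex_eq_iff)
  \<comment> \<open>The remainder \<open>k x - r\<^sup>2 P\<close> takes a real value at a nonreal point.\<close>
  have k: "k = 0" using im r0 \<theta> sin_gt_zero[of \<theta>] by auto
  hence P: "r^2 * P = - (r^4 * \<rho>^3)" using re by simp
  moreover have "r^4 * \<rho>^3 > 0" using r0 \<rho> by simp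
  ultimately have "r^2 * P < 0" by simp
  thus Pneg: "real_root_prod \<theta> < 0" using r0 by (simp add: P_def mult_less_0_iff)
  note ab = real_quadratic_roots[OF Pneg, of "real_root_sum \<theta>",
     folded pos_root_def neg_root_def a_def b_def P_def S_def]
  show b: "b < 0" by fact
  show "a * b = real_root_prod \<theta>" using ab(2) by (simp add: P_def)
  show factor: "x * (x - 1)^3 =
      (x^2 - 2 * cos \<theta> * r * x + r^2) * ((x - a) * (x - b)) - r^2 * real_root_prod \<theta>" for x
  proof -
    have "x * (x - 1)^3 = (x^2 - 2 * cos \<theta> * r * x + r^2) * (x^2 - S * x + P) - r^2 * P"
      using quartic_identity[of x "2 * cos \<theta>" r] k
      by (simp add: k_def S_def P_def real_root_sum_def real_root_prod_def r_def)
    also have "x^2 - S * x + P = (x - a) * (x - b)"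
      using ab by (simp add: algebra_simps power2_eq_square flip: ab(1,2))
    finally show ?thesis by (simp add: P_def)
  qed
  have qa: "a * (a - 1)^3 = r^4 * \<rho>^3" and qb: "b * (b - 1)^3 = r^4 * \<rho>^3"
    using factor[of a] factor[of b] P by (simp_all add: P_def)
  have "a * (a - 1)^3 > 0" using qa r0 \<rho> by simp
  hence "(a - 1)^3 > 0" using ab by (simp add: zero_less_mult_iff)
  thus a: "a > 1" by (simp add: zero_less_power_eq)
  have \<Lambda>: "\<Lambda> = 4 * ln r + 3 * ln \<rho>"
  proof -
    have "\<Lambda> = ln a + ln ((-b) * r^2)"
      using b r0 ln_mult[of "-b" "r^2"] by (simp add: \<Lambda>_def ln_realpow)
    also have "\<dots> = ln (a * ((-b) * r^2))"
      using ln_mult_pos[of a "(-b) * r^2"] a b r0 by (simp add: mult_less_0_iff)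
    also have "a * ((-b) * r^2) = - (r^2 * (a * b))" by (simp add: mult_ac)
    also have "\<dots> = r^4 * \<rho>^3" by (simp only: ab(2) P minus_minus)
    also have "ln \<dots> = 4 * ln r + 3 * ln \<rho>" using r0 \<rho> by (simp add: ln_mult ln_realpow)
    finally show ?thesis .
  qed
  have "ln (a * (a - 1)^3) = \<Lambda>" unfolding qa \<Lambda> using r0 \<rho> by (simp add: ln_mult ln_realpow)
  moreover have "1 - 1 / a = (a - 1) / a" using a by (simp add: field_simps)
  ultimately show "ln (1 - 1 / a) = (\<Lambda> - 4 * ln a) / 3"
    using a by (simp add: ln_mult ln_realpow ln_div field_simps)
  have "ln (1 - 1 / b) = (\<Lambda> - 4 * ln y) / 3" if y: "y = -b" for y
  proof -
    have "y * (1 + y)^3 = b * (b - 1)^3"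
      by (simp add: y power3_eq_cube algebra_simps)
    hence "ln (y * (1 + y)^3) = \<Lambda>"
      unfolding qb \<Lambda> using r0 \<rho>(1) by (simp add: ln_mult ln_realpow)
    moreover have "y > 0" using b by (simp add: y)
    moreover have "1 - 1 / b = (1 + y) / y" using b by (simp add: y field_simps)
    hence "ln (1 - 1 / b) = ln (1 + y) - ln y" using \<open>y > 0\<close> by (simp only: ln_div) simp
    ultimately show ?thesis by (simp add: ln_mult ln_realpow)
  qed
  thus "ln (1 - 1 / b) = (\<Lambda> - 4 * ln (-b)) / 3" by blast
  have "sin ((2 * pi - 4 * \<theta>) / 3) > 0" using \<theta> by (intro sin_gt_zero) auto
  hence "Im (1 - 1 / rcis r \<theta>) \<noteq> 0" unfolding \<rho>(2) using \<rho>(1) by simp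
  thus "1 / rcis r \<theta> \<in> dilog_domain"
    unfolding dilog_domain_def complex_nonpos_Reals_iff by blast
  show "Ln (1 - 1 / rcis r \<theta>) = Complex ((\<Lambda> - 4 * ln r) / 3) ((2 * pi - 4 * \<theta>) / 3)"
    unfolding \<rho>(2) using \<rho>(1) \<theta> by (subst Ln_rcis) (auto simp: \<Lambda>)
qed

section \<open>The sum of the dilogarithms is elementary\<close>

text \<open>
  The sum over all four roots; the conjugate of the nonreal root contributes the same real part.
\<close>
definition dilog_sum :: "real \<Rightarrow> real" where
  "dilog_sum \<theta> = Re (dilog (1 / of_real (pos_root \<theta>))) + Re (dilog (1 / of_real (neg_root \<theta>)))
     + 2 * Re (dilog (1 / rcis (root_modulus \<theta>) \<theta>))"

text \<open>
  A primitive of the derivative of the sum of dilogarithms, with the constant of integration that makes it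
  vanish as \<open>\<theta>\<close> tends to \<open>\<pi>/2\<close>.
\<close>
definition log_form :: "real \<Rightarrow> real" where
  "log_form \<theta> = (ln (pos_root \<theta>) + ln (- neg_root \<theta>) + 2 * ln (root_modulus \<theta>))^2 / 6
     - 2 / 3 * ((ln (pos_root \<theta>))^2 + (ln (- neg_root \<theta>))^2 + 2 * (ln (root_modulus \<theta>))^2)
     + (pi - 2 * \<theta>)^2 / 3"

lemma root_differentiable:
  assumes \<theta>: "0 < \<theta>" "\<theta> < pi / 2"
  obtains a' b' r' where "(pos_root has_real_derivative a') (at \<theta>)"
    "(neg_root has_real_derivative b') (at \<theta>)" "(root_modulus has_real_derivative r') (at \<theta>)"
proof -
  have s: "sin ((pi + 4 * \<theta>) / 3) \<noteq> 0"
    using sin_gt_zero[of "(pi + 4 * \<theta>) / 3"] \<theta> by auto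
  have "\<exists>r'. (root_modulus has_real_derivative r') (at \<theta>)"
    unfolding root_modulus_def[abs_def] by (rule exI) (rule derivative_eq_intros refl s | simp)+
  then obtain r' where r': "(root_modulus has_real_derivative r') (at \<theta>)" by blast
  have "\<exists>d. (real_root_sum has_real_derivative d) (at \<theta>)"
    unfolding real_root_sum_def[abs_def] by (rule exI) (rule derivative_eq_intros refl r')+
  then obtain S' where S': "(real_root_sum has_real_derivative S') (at \<theta>)" by blast
  have "\<exists>d. (real_root_prod has_real_derivative d) (at \<theta>)"
    unfolding real_root_prod_def[abs_def] by (rule exI) (rule derivative_eq_intros refl r')+
  then obtain P' where P': "(real_root_prod has_real_derivative P') (at \<theta>)" by blast
  have D: "(real_root_sum \<theta>)^2 - 4 * real_root_prod \<theta> > 0"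
    using root_system(3)[OF \<theta>] by (smt (verit) zero_le_power2)
  have "\<exists>d. ((\<lambda>t. (real_root_sum t)^2 - 4 * real_root_prod t) has_real_derivative d) (at \<theta>)"
    by (rule exI) (rule derivative_eq_intros refl S' P')+
  then obtain D' where "((\<lambda>t. (real_root_sum t)^2 - 4 * real_root_prod t) has_real_derivative D') (at \<theta>)" by blast
  note q' = DERIV_chain2[OF DERIV_real_sqrt[OF D] this]
  have "\<exists>d. (pos_root has_real_derivative d) (at \<theta>)"
    unfolding pos_root_def[abs_def] by (rule exI) (rule derivative_eq_intros refl S' q')+
  moreover have "\<exists>d. (neg_root has_real_derivative d) (at \<theta>)"
    unfolding neg_root_def[abs_def] by (rule exI) (rule derivative_eq_intros refl S' q')+
  ultimately show ?thesis using that r' by blast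
qed

lemma has_vector_derivative_polar:
  assumes "(r has_real_derivative r') (at t)"
  shows "((\<lambda>t. rcis (r t) t) has_vector_derivative (of_real r' + \<i> * of_real (r t)) * cis t) (at t)"
proof -
  have "((\<lambda>t. of_real (r t)) has_vector_derivative of_real r') (at t)"
    using assms by (auto intro!: has_vector_derivative_of_real
        simp: has_real_derivative_iff_has_vector_derivative)
  moreover have "(cis has_vector_derivative \<i> * cis t) (at t)"
  proof -
    have "((\<lambda>t. Complex (cos t) (sin t)) has_vector_derivative Complex (- sin t) (cos t)) (at t)"
      unfolding has_vector_derivative_complex_iff
      by (auto intro!: derivative_eq_intros simp flip: has_real_derivative_iff_has_vector_derivative)
    moreover have "Complex (- sin t) (cos t) = \<i> * cis t" by (simp add: complex_eq_iff)
    moreover have "(\<lambda>t. Complex (cos t) (sin t)) = cis" by (auto simp: complex_eq_iff)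
    ultimately show ?thesis by simp
  qed
  ultimately have "((\<lambda>t. of_real (r t) * cis t) has_vector_derivative
      of_real (r t) * (\<i> * cis t) + of_real r' * cis t) (at t)"
    by (rule has_vector_derivative_mult)
  thus ?thesis by (simp add: rcis_def algebra_simps)
qed

lemma has_real_derivative_log_quadratic:
  assumes "(La has_real_derivative A') (at t)" "(Lb has_real_derivative B') (at t)"
    "(Lr has_real_derivative R') (at t)"
  shows "((\<lambda>t. (La t + Lb t + 2 * Lr t)^2 / 6
            - 2 / 3 * ((La t)^2 + (Lb t)^2 + 2 * (Lr t)^2) + (pi - 2 * t)^2 / 3)
          has_real_derivative
            (La t + Lb t + 2 * Lr t) * (A' + B' + 2 * R') / 3
            - 4 / 3 * (La t * A' + Lb t * B' + 2 * Lr t * R') - 4 / 3 * (pi - 2 * t)) (at t)"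
proof -
  have 1: "((\<lambda>t. (La t + Lb t + 2 * Lr t)^2 / 6) has_real_derivative
      (La t + Lb t + 2 * Lr t) * (A' + B' + 2 * R') / 3) (at t)"
    by (rule derivative_eq_intros refl assms zero_neq_numeral[symmetric])+ simp
  have 2: "((\<lambda>t. 2 / 3 * ((La t)^2 + (Lb t)^2 + 2 * (Lr t)^2)) has_real_derivative
      4 / 3 * (La t * A' + Lb t * B' + 2 * Lr t * R')) (at t)"
    by (rule derivative_eq_intros refl assms)+ (simp add: algebra_simps)
  have 3: "((\<lambda>t. (pi - 2 * t)^2 / 3) has_real_derivative - 4 / 3 * (pi - 2 * t)) (at t)"
    by (rule derivative_eq_intros refl zero_neq_numeral[symmetric])+ (simp add: field_simps)
  from DERIV_add[OF DERIV_diff[OF 1 2] 3] show ?thesis by simp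
qed
text \<open>
  The four derivatives \<open>Re (Ln (1 - 1/x) \<cdot> x'/x)\<close> add up to the derivative of the logarithmic expression.  For
  the nonreal root \<open>x'/x = r'/r + i\<close>, so the argument of \<open>1 - 1/x\<close> enters the real part and produces
  the term in \<open>\<pi> - 2\<theta>\<close>.
\<close>
lemma dilog_sum_deriv:
  assumes \<theta>: "0 < \<theta>" "\<theta> < pi / 2"
  shows "((\<lambda>t. dilog_sum t - log_form t) has_real_derivative 0) (at \<theta>)"
proof -
  define a b r where "a = pos_root \<theta>" "b = neg_root \<theta>" "r = root_modulus \<theta>"
  note abr = this
  define \<Lambda> where "\<Lambda> = ln a + ln (-b) + 2 * ln r"
  note rs = root_system[OF \<theta>, folded abr, folded \<Lambda>_def]
  have r: "r > 0" using root_modulus_pos[OF \<theta>] by (simp add: abr)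
  obtain a' b' r' where d: "(pos_root has_real_derivative a') (at \<theta>)"
    "(neg_root has_real_derivative b') (at \<theta>)" "(root_modulus has_real_derivative r') (at \<theta>)"
    using root_differentiable[OF \<theta>] .
  have real_part: "((\<lambda>t. Re (dilog (1 / of_real (f t)))) has_real_derivative ln (1 - 1 / f \<theta>) * (f' / f \<theta>)) (at \<theta>)"
    if f: "(f has_real_derivative f') (at \<theta>)" and f0: "f \<theta> > 1 \<or> f \<theta> < 0" for f f'
  proof -
    have pos: "1 - 1 / f \<theta> > 0" using f0 by (auto simp: field_simps)
    have *: "1 - 1 / complex_of_real (f \<theta>) = of_real (1 - 1 / f \<theta>)" by simp
    have "((\<lambda>t. complex_of_real (f t)) has_vector_derivative of_real f') (at \<theta>)"
      using f by (auto intro!: has_vector_derivative_of_real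
        simp: has_real_derivative_iff_has_vector_derivative)
    moreover have "1 / complex_of_real (f \<theta>) \<in> dilog_domain"
      unfolding dilog_domain_def mem_Collect_eq * using pos by (auto simp: complex_nonpos_Reals_iff)
    ultimately have "((\<lambda>t. Re (dilog (1 / of_real (f t)))) has_real_derivative
        Re (Ln (1 - 1 / of_real (f \<theta>)) * (of_real f' / of_real (f \<theta>)))) (at \<theta>)"
      using f0 by (intro has_real_derivative_Re_dilog_inverse) auto
    also have "Re (Ln (1 - 1 / of_real (f \<theta>)) * (of_real f' / of_real (f \<theta>))) = ln (1 - 1 / f \<theta>) * (f' / f \<theta>)"
      unfolding * Ln_of_real[OF pos] by (simp flip: of_real_mult of_real_divide)
    finally show ?thesis .
  qed
  have da: "((\<lambda>t. Re (dilog (1 / of_real (pos_root t)))) has_real_derivative (\<Lambda> - 4 * ln a) / 3 * (a' / a)) (at \<theta>)"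
    using real_part[OF d(1)] rs(1) unfolding rs(6)[symmetric] by (simp add: abr)
  have db: "((\<lambda>t. Re (dilog (1 / of_real (neg_root t)))) has_real_derivative (\<Lambda> - 4 * ln (-b)) / 3 * (b' / b)) (at \<theta>)"
    using real_part[OF d(2)] rs(2) unfolding rs(7)[symmetric] by (simp add: abr)
  have dc: "((\<lambda>t. Re (dilog (1 / rcis (root_modulus t) t))) has_real_derivative
      (\<Lambda> - 4 * ln r) / 3 * (r' / r) - (2 * pi - 4 * \<theta>) / 3) (at \<theta>)"
  proof -
    have "((\<lambda>t. Re (dilog (1 / rcis (root_modulus t) t))) has_real_derivative
        Re (Ln (1 - 1 / rcis (root_modulus \<theta>) \<theta>) * ((of_real r' + \<i> * of_real (root_modulus \<theta>)) * cis \<theta> / rcis (root_modulus \<theta>) \<theta>))) (at \<theta>)"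
      using r rs by (intro has_real_derivative_Re_dilog_inverse has_vector_derivative_polar d) (auto simp: abr)
    also have "(of_real r' + \<i> * of_real (root_modulus \<theta>)) * cis \<theta> / rcis (root_modulus \<theta>) \<theta>
        = (of_real r' + \<i> * of_real r) / of_real r"
      by (simp add: rcis_def abr(3))
    also have "\<dots> = Complex (r' / r) 1"
      using r by (simp add: complex_eq_iff Re_divide_of_real Im_divide_of_real)
    finally show ?thesis using rs(9) by (simp add: abr)
  qed
  have la: "((\<lambda>t. ln (pos_root t)) has_real_derivative a' / a) (at \<theta>)"
    using rs by (auto intro!: derivative_eq_intros d simp: abr)
  have lb: "((\<lambda>t. ln (- neg_root t)) has_real_derivative b' / b) (at \<theta>)"
    using rs by (auto intro!: derivative_eq_intros d simp: abr)
  have lr: "((\<lambda>t. ln (root_modulus t)) has_real_derivative r' / r) (at \<theta>)"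
    using r by (auto intro!: derivative_eq_intros d simp: abr)
  note dlog = has_real_derivative_log_quadratic[OF la lb lr, folded abr]
  have "((\<lambda>t. dilog_sum t - log_form t) has_real_derivative
      (\<Lambda> - 4 * ln a) / 3 * (a' / a) + (\<Lambda> - 4 * ln (-b)) / 3 * (b' / b)
      + 2 * ((\<Lambda> - 4 * ln r) / 3 * (r' / r) - (2 * pi - 4 * \<theta>) / 3)
      - (\<Lambda> * (a' / a + b' / b + 2 * (r' / r)) / 3
         - 4 / 3 * (ln a * (a' / a) + ln (-b) * (b' / b) + 2 * ln r * (r' / r))
         - 4 / 3 * (pi - 2 * \<theta>))) (at \<theta>)"
    unfolding dilog_sum_def log_form_def
    by (intro DERIV_diff DERIV_add DERIV_cmult da db dc dlog[folded \<Lambda>_def])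
  moreover have zero: "(\<Lambda> - 4 * ln a) / 3 * A' + (\<Lambda> - 4 * ln (-b)) / 3 * B'
      + 2 * ((\<Lambda> - 4 * ln r) / 3 * R' - (2 * pi - 4 * \<theta>) / 3)
      - (\<Lambda> * (A' + B' + 2 * R') / 3 - 4 / 3 * (ln a * A' + ln (-b) * B' + 2 * ln r * R')
         - 4 / 3 * (pi - 2 * \<theta>)) = 0" for A' B' R'
    by (simp add: field_simps)
  ultimately show ?thesis by (simp only: zero)
qed

lemma dilog_tendsto_0:
  assumes "(f \<longlongrightarrow> 0) F"
  shows "((\<lambda>x. Re (dilog (f x))) \<longlongrightarrow> 0) F"
proof -
  have "isCont dilog 0" by (rule isCont_dilog) (simp add: dilog_domain_def)
  from isCont_tendsto_compose[OF this assms] have "((\<lambda>x. dilog (f x)) \<longlongrightarrow> 0) F" by simp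
  from tendsto_Re[OF this] show ?thesis by simp
qed

text \<open>
  The quadratic form in the logarithms depends only on their differences.  This is why it stays bounded, and indeed
  tends to \<open>0\<close>, although each of the logarithms diverges as \<open>\<theta>\<close> tends to \<open>\<pi>/2\<close>.
\<close>
lemma log_form_expand:
  fixes l u v :: real
  shows "((l + u) + (l + v) + 2 * l)^2 / 6 - 2 / 3 * ((l + u)^2 + (l + v)^2 + 2 * l^2)
           = (u + v)^2 / 6 - 2 / 3 * (u^2 + v^2)"
  by (simp add: power2_eq_square field_simps)

text \<open>
  The reciprocal \<open>u\<close> of the modulus extends continuously to \<open>\<pi>/2\<close> with the value \<open>0\<close>.  The real roots divided by
  the modulus, \<open>A\<close> and \<open>-B\<close> below, are continuous functions of \<open>u\<close> and \<open>cos \<theta>\<close>, and tend to \<open>1\<close> and \<open>-1\<close>.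
\<close>
lemma dilog_sum_limit:
  "((\<lambda>t. dilog_sum t - log_form t) \<longlongrightarrow> 0) (at_left (pi / 2))"
proof -
  define u :: "real \<Rightarrow> real" where "u = (\<lambda>t. sin ((pi + 4 * t) / 3) / sin ((pi + t) / 3))"
  define s where "s = (\<lambda>t. 3 * u t - 2 * cos t)"
  define p where "p = (\<lambda>t. 3 * (u t)^2 - 1 - 3 * (2 * cos t) * u t + (2 * cos t)^2)"
  define A where "A = (\<lambda>t. 1 / 2 * (s t + sqrt ((s t)^2 - 4 * p t)))"
  define B where "B = (\<lambda>t. - (1 / 2 * (s t - sqrt ((s t)^2 - 4 * p t))))"
  have ev: "eventually (\<lambda>t. t \<in> {0<..<pi / 2}) (at_left (pi / 2))"
    by (rule eventually_at_left_real) simp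
  have "isCont u (pi / 2)" unfolding u_def by (intro continuous_intros) simp_all
  hence "(u \<longlongrightarrow> u (pi / 2)) (at_left (pi / 2))"
    by (auto simp: isCont_def intro: tendsto_within_subset)
  moreover have "u (pi / 2) = 0"
  proof -
    have "(pi + 4 * (pi / 2)) / 3 = pi" by simp
    thus ?thesis unfolding u_def by (simp only: sin_pi)
  qed
  ultimately have u: "(u \<longlongrightarrow> 0) (at_left (pi / 2))" by simp
  have "isCont cos (pi / 2 :: real)" by simp
  hence c: "(cos \<longlongrightarrow> (0::real)) (at_left (pi / 2))"
    by (auto simp: isCont_def intro: tendsto_within_subset)
  have s: "(s \<longlongrightarrow> 3 * 0 - 2 * 0) (at_left (pi / 2))"
    unfolding s_def by (intro tendsto_intros u c)
  have p: "(p \<longlongrightarrow> 3 * 0^2 - 1 - 3 * (2 * 0) * 0 + (2 * 0)^2) (at_left (pi / 2))"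
    unfolding p_def by (intro tendsto_intros u c)
  have "(A \<longlongrightarrow> 1 / 2 * ((3 * 0 - 2 * 0) + sqrt ((3 * 0 - 2 * 0)^2 - 4 * (3 * 0^2 - 1 - 3 * (2 * 0) * 0 + (2 * 0)^2))))
      (at_left (pi / 2))"
    unfolding A_def by (intro tendsto_intros s p)
  hence A: "(A \<longlongrightarrow> 1) (at_left (pi / 2))" by simp
  have "(B \<longlongrightarrow> - (1 / 2 * ((3 * 0 - 2 * 0) - sqrt ((3 * 0 - 2 * 0)^2 - 4 * (3 * 0^2 - 1 - 3 * (2 * 0) * 0 + (2 * 0)^2)))))
      (at_left (pi / 2))"
    unfolding B_def by (intro tendsto_intros s p)
  hence B: "(B \<longlongrightarrow> 1) (at_left (pi / 2))" by simp
  have main: "root_modulus t = 1 / u t \<and> pos_root t = root_modulus t * A t \<and> neg_root t = - (root_modulus t * B t)"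
    if t: "0 < t" "t < pi / 2" for t
  proof -
    have r: "root_modulus t > 0" by (rule root_modulus_pos[OF t])
    have ru: "u t = 1 / root_modulus t" by (simp add: u_def root_modulus_def)
    have S: "real_root_sum t = root_modulus t * s t" using r by (simp add: real_root_sum_def s_def ru algebra_simps)
    have P: "real_root_prod t = (root_modulus t)^2 * p t" using r
      by (simp add: real_root_prod_def p_def ru field_simps power2_eq_square)
    have "(real_root_sum t)^2 - 4 * real_root_prod t = (root_modulus t)^2 * ((s t)^2 - 4 * p t)"
      by (simp add: S P algebra_simps power_mult_distrib)
    hence q: "sqrt ((real_root_sum t)^2 - 4 * real_root_prod t) = root_modulus t * sqrt ((s t)^2 - 4 * p t)"
      using r by (simp add: real_sqrt_mult)
    have "pos_root t = root_modulus t * A t"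
      unfolding pos_root_def A_def q by (simp only: S) (simp add: distrib_left)
    moreover have "neg_root t = - (root_modulus t * B t)"
      unfolding neg_root_def B_def q by (simp only: S) (simp add: right_diff_distrib)
    ultimately show ?thesis by (simp add: ru)
  qed
  have "((\<lambda>t. complex_of_real (u t / A t)) \<longlongrightarrow> 0) (at_left (pi / 2))"
    using tendsto_of_real[OF tendsto_divide[OF u A], where ?'a = complex] by simp
  note da = dilog_tendsto_0[OF this]
  have "((\<lambda>t. complex_of_real (- (u t / B t))) \<longlongrightarrow> 0) (at_left (pi / 2))"
    using tendsto_of_real[OF tendsto_minus[OF tendsto_divide[OF u B]], where ?'a = complex] by simp
  note db = dilog_tendsto_0[OF this]
  have "((\<lambda>t. complex_of_real (u t) * cis (- t)) \<longlongrightarrow> 0) (at_left (pi / 2))"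
    by (rule tendsto_norm_zero_cancel) (use tendsto_rabs_zero[OF u] in \<open>simp add: norm_mult\<close>)
  note dc = dilog_tendsto_0[OF this]
  have lnA: "((\<lambda>t. ln (A t)) \<longlongrightarrow> 0) (at_left (pi / 2))"
    using tendsto_ln[OF A] by simp
  have lnB: "((\<lambda>t. ln (B t)) \<longlongrightarrow> 0) (at_left (pi / 2))"
    using tendsto_ln[OF B] by simp
  have "((\<lambda>t. (ln (A t) + ln (B t))^2 / 6 - 2 / 3 * ((ln (A t))^2 + (ln (B t))^2) + (pi - 2 * t)^2 / 3)
      \<longlongrightarrow> (0 + 0)^2 / 6 - 2 / 3 * (0^2 + 0^2) + (pi - 2 * (pi / 2))^2 / 3) (at_left (pi / 2))"
    by (intro tendsto_add tendsto_diff tendsto_mult tendsto_divide tendsto_power tendsto_const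
        tendsto_ident_at lnA lnB) simp_all
  note tendsto_diff[OF tendsto_add[OF tendsto_add[OF da db] tendsto_mult_left[OF dc, of 2]] this]
  hence "((\<lambda>t. Re (dilog (of_real (u t / A t))) + Re (dilog (of_real (- (u t / B t))))
         + 2 * Re (dilog (of_real (u t) * cis (- t)))
         - ((ln (A t) + ln (B t))^2 / 6 - 2 / 3 * ((ln (A t))^2 + (ln (B t))^2) + (pi - 2 * t)^2 / 3))
      \<longlongrightarrow> 0) (at_left (pi / 2))" by simp
  moreover have "eventually (\<lambda>t. Re (dilog (of_real (u t / A t))) + Re (dilog (of_real (- (u t / B t))))
         + 2 * Re (dilog (of_real (u t) * cis (- t)))
         - ((ln (A t) + ln (B t))^2 / 6 - 2 / 3 * ((ln (A t))^2 + (ln (B t))^2) + (pi - 2 * t)^2 / 3)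
      = dilog_sum t - log_form t) (at_left (pi / 2))"
    using ev
  proof eventually_elim
    case (elim t)
    hence t: "0 < t" "t < pi / 2" by auto
    note m = main[OF t]
    have r: "root_modulus t > 0" by (rule root_modulus_pos[OF t])
    have "0 < root_modulus t * A t" "0 < root_modulus t * B t" using root_system(1,2)[OF t] m by linarith+
    hence AB: "A t > 0" "B t > 0" using r zero_less_mult_pos by blast+
    have "pos_root t = root_modulus t * A t" "- neg_root t = root_modulus t * B t" using m by simp_all
    hence ln: "ln (pos_root t) = ln (root_modulus t) + ln (A t)" "ln (- neg_root t) = ln (root_modulus t) + ln (B t)"
      using ln_mult_pos[OF r AB(1)] ln_mult_pos[OF r AB(2)] by simp_all
    have uA: "1 / pos_root t = u t / A t" "1 / neg_root t = - (u t / B t)"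
      using m r by simp_all
    have 1: "1 / complex_of_real (pos_root t) = of_real (u t / A t)"
      "1 / complex_of_real (neg_root t) = of_real (- (u t / B t))"
      unfolding uA[symmetric] by simp_all
    have "1 / rcis (root_modulus t) t = rcis (1 / root_modulus t) (- t)"
      by (simp only: rcis_inverse[symmetric] inverse_eq_divide)
    also have "1 / root_modulus t = u t" using m by simp
    finally have 2: "1 / rcis (root_modulus t) t = of_real (u t) * cis (- t)" by (simp only: rcis_def)
    show ?case unfolding dilog_sum_def log_form_def ln log_form_expand 1 2 by simp
  qed
  ultimately show ?thesis by (rule Lim_transform_eventually)
qed

lemma dilog_sum_eq_log_form:
  assumes "0 < \<theta>" "\<theta> < pi / 2"
  shows "dilog_sum \<theta> = log_form \<theta>"
proof -
  have "\<exists>c. \<forall>t\<in>{0<..<pi / 2}. dilog_sum t - log_form t = c"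
    by (intro has_field_derivative_zero_constant convex_real_interval
        has_field_derivative_at_within[OF dilog_sum_deriv]) auto
  then obtain c where c: "\<And>t. t \<in> {0<..<pi / 2} \<Longrightarrow> dilog_sum t - log_form t = c" by blast
  have "eventually (\<lambda>t. t \<in> {0<..<pi / 2}) (at_left (pi / 2))"
    by (rule eventually_at_left_real) simp
  hence "eventually (\<lambda>t. dilog_sum t - log_form t = c) (at_left (pi / 2))"
    by eventually_elim (rule c)
  from Lim_transform_eventually[OF dilog_sum_limit this] have "((\<lambda>_. c) \<longlongrightarrow> 0) (at_left (pi / 2))" .
  hence "c = 0" by (simp add: tendsto_const_iff trivial_limit_at_left_real)
  thus ?thesis using c[of \<theta>] assms by simp
qed

section \<open>The integral as a sum of dilogarithms\<close>

text \<open>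
  The primitive is the sum of the functions \<open>Re (Li\<^sub>2 (x / x\<^sub>i))\<close> over the four roots, which vanishes at \<open>0\<close>.
\<close>
lemma has_integral_dilog_sum:
  assumes \<theta>: "0 < \<theta>" "\<theta> < pi / 2"
  defines "z \<equiv> 1 / (real_root_prod \<theta> * (root_modulus \<theta>)^2)"
  shows "((\<lambda>x. - ln (1 - z * (x * (1 - x)^3)) / x) has_integral dilog_sum \<theta>) {0..1}"
proof -
  define a b r where "a = pos_root \<theta>" "b = neg_root \<theta>" "r = root_modulus \<theta>"
  note abr = this
  define c where "c = rcis r \<theta>"
  note rs = root_system[OF \<theta>, folded abr]
  have r: "r > 0" using root_modulus_pos[OF \<theta>] by (simp add: abr)
  hence c0: "c \<noteq> 0" by (simp add: c_def)
  define R where "R = (\<lambda>x. Re (dilog (of_real x / of_real a)) + Re (dilog (of_real x / of_real b))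
      + 2 * Re (dilog (of_real x / c)))"
  have pos: "1 - x / a > 0" "1 - x / b > 0" if "0 < x" "x \<le> 1" for x
  proof -
    have "x < a" using that rs(1) by linarith
    thus "1 - x / a > 0" using rs(1) by simp
    have "x / b < 0" using that rs(2) by (intro divide_pos_neg)
    thus "1 - x / b > 0" by simp
  qed
  have im: "Im (1 - of_real x / c) = x * sin \<theta> / r" for x
  proof -
    have "1 - of_real x / c = 1 - of_real x * inverse c"
      by (simp only: divide_inverse)
    also have "inverse c = rcis (1 / r) (- \<theta>)" unfolding c_def by (rule rcis_inverse)
    finally show ?thesis by simp
  qed
  have sin: "sin \<theta> > 0" using \<theta> by (intro sin_gt_zero) auto
  have dom0: "0 \<in> dilog_domain" by (simp add: dilog_domain_def)
  have dom: "of_real x / of_real a \<in> dilog_domain" "of_real x / of_real b \<in> dilog_domain"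
    "of_real x / c \<in> dilog_domain" if x: "x \<in> {0..1}" for x
  proof -
    have "1 - complex_of_real x / of_real a = of_real (1 - x / a)"
      "1 - complex_of_real x / of_real b = of_real (1 - x / b)" by simp_all
    moreover have "1 - x / a > 0 \<and> 1 - x / b > 0"
      using pos[of x] x by (cases "x = 0") auto
    ultimately show "of_real x / of_real a \<in> dilog_domain" "of_real x / of_real b \<in> dilog_domain"
      by (auto simp: dilog_domain_def complex_nonpos_Reals_iff)
    show "of_real x / c \<in> dilog_domain"
    proof (cases "x = 0")
      case False
      hence "Im (1 - of_real x / c) \<noteq> 0" unfolding im using sin r by simp
      thus ?thesis unfolding dilog_domain_def complex_nonpos_Reals_iff by blast
    qed (simp add: dom0)
  qed
  have cont: "continuous_on {0..1} (\<lambda>x. Re (dilog (of_real x / d)))"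
    if "\<And>x. x \<in> {0..1} \<Longrightarrow> of_real x / d \<in> dilog_domain" "d \<noteq> 0" for d
  proof (intro continuous_at_imp_continuous_on ballI)
    fix x :: real assume x: "x \<in> {0..1}"
    have "isCont (\<lambda>x. of_real x / d) x" using that(2) by (intro continuous_intros)
    from isCont_o2[OF this isCont_dilog[OF that(1)[OF x]]]
    show "isCont (\<lambda>x. Re (dilog (of_real x / d))) x" by (rule continuous_Re)
  qed
  have "((\<lambda>x. - ln (1 - z * (x * (1 - x)^3)) / x) has_integral R 1 - R 0) {0..1}"
  proof (rule fundamental_theorem_of_calculus_interior)
    show "continuous_on {0..1} R" unfolding R_def
      using rs(1,2) c0 by (intro continuous_intros cont dom) auto
    fix x :: real assume x: "x \<in> {0<..<1}"
    have "(R has_real_derivative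
        (- ln (cmod (1 - of_real x / of_real a)) / x) + (- ln (cmod (1 - of_real x / of_real b)) / x)
         + 2 * (- ln (cmod (1 - of_real x / c)) / x)) (at x)"
      unfolding R_def using x rs(1,2) c0
      by (intro DERIV_add DERIV_cmult has_real_derivative_Re_dilog_ray dom) auto
    also have "1 - complex_of_real x / of_real a = of_real (1 - x / a)" by simp
    also have "1 - complex_of_real x / of_real b = of_real (1 - x / b)" by simp
    also have "(- ln (cmod (of_real (1 - x / a))) / x) + (- ln (cmod (of_real (1 - x / b))) / x)
         + 2 * (- ln (cmod (1 - of_real x / c)) / x)
        = - (ln (1 - x / a) + ln (1 - x / b) + 2 * ln (cmod (1 - of_real x / c))) / x"
      using x pos[of x] unfolding norm_of_real by (simp add: field_simps)
    \<comment> \<open>The product of the four factors \<open>1 - x / x\<^sub>i\<close> is the quartic, normalised to \<open>1\<close> at \<open>0\<close>.\<close>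
    also have "ln (1 - x / a) + ln (1 - x / b) + 2 * ln (cmod (1 - of_real x / c))
       = ln (1 - z * (x * (1 - x)^3))"
    proof -
      have "Im (1 - of_real x / c) \<noteq> 0" unfolding im using sin r x by simp
      hence n0: "1 - of_real x / c \<noteq> 0" by auto
      have "(cmod (1 - of_real x / c))^2 = (cmod ((c - of_real x) / c))^2"
        using c0 by (simp add: diff_divide_distrib)
      also have "\<dots> = (cmod (c - of_real x))^2 / r^2"
        using r by (simp add: norm_divide power_divide c_def)
      also have "(cmod (c - of_real x))^2 = x^2 - 2 * cos \<theta> * r * x + r^2"
      proof -
        have "(cmod (c - of_real x))^2 = (r * cos \<theta> - x)^2 + (r * sin \<theta>)^2"
          by (simp add: cmod_power2 c_def)
        also have "\<dots> = x^2 - 2 * cos \<theta> * r * x + r^2"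
          using sin_cos_squared_add[of \<theta>] by algebra
        finally show ?thesis .
      qed
      finally have n: "(cmod (1 - of_real x / c))^2 = (x^2 - 2 * cos \<theta> * r * x + r^2) / r^2" .
      have "ln (1 - x / a) + ln (1 - x / b) + 2 * ln (cmod (1 - of_real x / c))
          = ln (1 - x / a) + ln (1 - x / b) + ln ((cmod (1 - of_real x / c))^2)"
        using n0 by (simp add: ln_realpow)
      also have "\<dots> = ln ((1 - x / a) * (1 - x / b) * (cmod (1 - of_real x / c))^2)"
      proof -
        have "0 < 1 - x / a" "0 < 1 - x / b" "0 < (cmod (1 - of_real x / c))^2"
          using pos[of x] x n0 by simp_all
        thus ?thesis by (simp only: ln_mult_pos mult_pos_pos)
      qed
      also have "(1 - x / a) * (1 - x / b) * (cmod (1 - of_real x / c))^2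
          = (x^2 - 2 * cos \<theta> * r * x + r^2) * ((x - a) * (x - b)) / (r^2 * (a * b))"
        unfolding n using rs(1,2) r by (simp add: field_simps)
      also have "(x^2 - 2 * cos \<theta> * r * x + r^2) * ((x - a) * (x - b)) = x * (x - 1)^3 + r^2 * real_root_prod \<theta>"
        using rs(5)[of x] by simp
      also have "(x * (x - 1)^3 + r^2 * real_root_prod \<theta>) / (r^2 * (a * b)) = 1 + z * (x * (x - 1)^3)"
        using rs(3) r unfolding rs(4) by (simp add: z_def abr(3)[symmetric] field_simps)
      also have "\<dots> = 1 - z * (x * (1 - x)^3)"
        by (simp add: power3_eq_cube algebra_simps)
      finally show ?thesis .
    qed
    finally show "(R has_vector_derivative - ln (1 - z * (x * (1 - x)^3)) / x) (at x)"
      by (simp add: has_real_derivative_iff_has_vector_derivative)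
  qed auto
  moreover have "R 1 - R 0 = dilog_sum \<theta>"
    by (simp add: R_def dilog_sum_def abr c_def)
  ultimately show ?thesis by simp
qed

section \<open>The evaluation of the hypergeometric series\<close>

theorem theorem11:
  fixes j N :: int and \<theta> \<kappa> r S P z a b :: real
  assumes "0 < j" and "j < N" and "gcd j N = 1"
    and "\<theta> = of_int j * pi / of_int N"
    and "\<kappa> = 2 * cos \<theta>"
    and "r > 0"
    and "(\<kappa>^3 - 2 * \<kappa>) * r^3 + 3 * (1 - \<kappa>^2) * r^2 + 3 * \<kappa> * r - 1 = 0"
    and "S = 3 - \<kappa> * r"
    and "P = 3 - r^2 - 3 * \<kappa> * r + \<kappa>^2 * r^2"
    and "P \<noteq> 0"
    and "z = 1 / (P * r^2)"
    and "a = 1 / 2 * (S + sqrt (S^2 - 4 * P))"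
    and "b = 1 / 2 * (S - sqrt (S^2 - 4 * P))"
    and "S^2 - 4 * P > 0"
    and "\<bar>z\<bar> < 256 / 27"
  shows "z < 0 \<and> a > 0 \<and> 0 > b
    \<and> r = sin ((pi + \<theta>) / 3) / sin ((pi + 4 * \<theta>) / 3)
    \<and> proots [:complex_of_real (1 / z), -1, 3, -3, 1:]
        = {#complex_of_real a, complex_of_real b,
            complex_of_real r * exp (\<i> * complex_of_real \<theta>),
            complex_of_real r * exp (- \<i> * complex_of_real \<theta>)#}
    \<and> - (z / 4) * hypergeo [1, 1, 1, 4/3, 5/3] [5/4, 3/2, 7/4, 2] (27 * z / 256)
        = - (1 / 3) * (1 - 2 * of_int j / of_int N)^2 * pi^2
          + 1 / 2 * (ln a)^2 + 1 / 2 * (ln \<bar>b\<bar>)^2 + 2 / 3 * (ln r)^2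
          - 1 / 3 * ln a * ln \<bar>b\<bar> - 2 / 3 * ln r * (ln a + ln \<bar>b\<bar>)"
proof -
  note r0 = \<open>r > 0\<close> and zdef = \<open>z = 1 / (P * r^2)\<close>
  have \<theta>: "0 < \<theta>" "\<theta> < pi"
  proof -
    have "0 < real_of_int j" "real_of_int j < of_int N" using assms(1,2) by simp_all
    thus "0 < \<theta>" "\<theta> < pi"
      unfolding assms(4) by (simp_all add: pos_divide_less_eq mult.commute[of _ pi])
  qed
  have sum: "a + b = S" by (simp add: assms(12,13) field_simps)
  have prod: "a * b = P"
  proof -
    have "a * b = (S^2 - (sqrt (S^2 - 4 * P))^2) / 4"
      by (simp add: assms(12,13) power2_eq_square algebra_simps)
    thus ?thesis using assms(14) by simp
  qed
  have iz: "1 / z = r^2 * P" using r0 by (simp add: zdef)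
  have quartic: "x * (x - 1)^3 = (x^2 - \<kappa> * r * x + r^2) * (x^2 - S * x + P) - r^2 * P" for x
    using quartic_identity[of x \<kappa> r] assms(7-9) by simp
  \<comment> \<open>The real root \<open>a\<close> bounds \<open>1/z = a (1 - a)\<^sup>3\<close> from above, so a positive \<open>z\<close> would be too large.\<close>
  have "a * (a - 1)^3 = - (r^2 * P)"
    using quartic[of a] by (simp add: power2_eq_square algebra_simps flip: sum prod)
  hence "r^2 * P = a * (1 - a)^3" by (simp add: power3_eq_cube algebra_simps)
  hence iz_le: "1 / z \<le> 27 / 256" using iz quartic_le[of a] by simp
  have z0: "z < 0"
  proof (rule ccontr)
    assume "\<not> z < 0"
    moreover have "z \<noteq> 0" using r0 assms(10) by (simp add: zdef)
    ultimately have "z > 0" by simp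
    with iz_le have "z \<ge> 256 / 27" by (simp add: field_simps)
    with assms(15) \<open>z > 0\<close> show False by simp
  qed
  have "r^2 * P < 0" using z0 iz by (metis divide_less_0_iff zero_less_one less_asym)
  hence "P < 0" using r0 by (simp add: mult_less_0_iff)
  note ab = real_quadratic_roots(3,4)[OF this, of S, folded assms(12,13)]
  define c where "c = rcis r \<theta>"
  \<comment> \<open>The cubic equation for \<open>r\<close> makes \<open>r e\<^bsup>i\<theta>\<^esup>\<close> a root, which fixes \<open>r\<close> and gives \<open>\<theta> < \<pi>/2\<close>.\<close>
  have "c * (c - 1)^3 = of_real (- (r^2 * P))"
    using quartic_identity[of c "of_real \<kappa>" "of_real r"] rcis_quadratic_zero[of r \<theta>]
      arg_cong[OF assms(7), of complex_of_real]
    by (simp add: c_def assms(5,9))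
  moreover have "- (r^2 * P) > 0" using \<open>P < 0\<close> r0 by (simp add: mult_pos_neg)
  ultimately have \<theta>2: "\<theta> < pi / 2" and r: "r = root_modulus \<theta>"
    using upper_root_forced[OF \<theta> r0] unfolding c_def by blast+
  have S: "S = real_root_sum \<theta>" and P: "P = real_root_prod \<theta>"
    by (simp_all add: assms(5,8,9) r real_root_sum_def real_root_prod_def)
  have a: "a = pos_root \<theta>" and b: "b = neg_root \<theta>"
    by (simp_all add: assms(12,13) S P pos_root_def neg_root_def)
  have zP: "z = 1 / (real_root_prod \<theta> * (root_modulus \<theta>)^2)" by (simp add: zdef P r)
  have expand: "- ((A + B + 2 * L)^2 / 6 - 2 / 3 * (A^2 + B^2 + 2 * L^2) + (x * p)^2 / 3)
      = - (1 / 3) * x^2 * p^2 + 1 / 2 * A^2 + 1 / 2 * B^2 + 2 / 3 * L^2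
        - 1 / 3 * A * B - 2 / 3 * L * (A + B)" for A B L x p :: real
    by (simp add: power2_eq_square field_simps)
  have "z / 4 * hypergeo [1, 1, 1, 4/3, 5/3] [5/4, 3/2, 7/4, 2] (27 * z / 256) = dilog_sum \<theta>"
    using has_integral_hypergeo[OF assms(15)] has_integral_dilog_sum[OF \<theta>(1) \<theta>2, folded zP]
    by (rule has_integral_unique)
  also have "\<dots> = log_form \<theta>" using \<theta>(1) \<theta>2 by (rule dilog_sum_eq_log_form)
  finally have "- (z / 4) * hypergeo [1, 1, 1, 4/3, 5/3] [5/4, 3/2, 7/4, 2] (27 * z / 256) = - log_form \<theta>"
    by simp
  also have "log_form \<theta> = (ln a + ln \<bar>b\<bar> + 2 * ln r)^2 / 6
     - 2 / 3 * ((ln a)^2 + (ln \<bar>b\<bar>)^2 + 2 * (ln r)^2) + (pi - 2 * \<theta>)^2 / 3"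
    using ab by (simp add: log_form_def a b r)
  also have "pi - 2 * \<theta> = (1 - 2 * of_int j / of_int N) * pi"
    by (simp add: assms(4) algebra_simps)
  also have "- ((ln a + ln \<bar>b\<bar> + 2 * ln r)^2 / 6
     - 2 / 3 * ((ln a)^2 + (ln \<bar>b\<bar>)^2 + 2 * (ln r)^2) + ((1 - 2 * of_int j / of_int N) * pi)^2 / 3)
     = - (1 / 3) * (1 - 2 * of_int j / of_int N)^2 * pi^2
          + 1 / 2 * (ln a)^2 + 1 / 2 * (ln \<bar>b\<bar>)^2 + 2 / 3 * (ln r)^2
          - 1 / 3 * ln a * ln \<bar>b\<bar> - 2 / 3 * ln r * (ln a + ln \<bar>b\<bar>)"
    by (rule expand)
  finally have formula: "- (z / 4) * hypergeo [1, 1, 1, 4/3, 5/3] [5/4, 3/2, 7/4, 2] (27 * z / 256)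
     = - (1 / 3) * (1 - 2 * of_int j / of_int N)^2 * pi^2
          + 1 / 2 * (ln a)^2 + 1 / 2 * (ln \<bar>b\<bar>)^2 + 2 / 3 * (ln r)^2
          - 1 / 3 * ln a * ln \<bar>b\<bar> - 2 / 3 * ln r * (ln a + ln \<bar>b\<bar>)" .
  have "proots [:complex_of_real (1 / z), -1, 3, -3, 1:]
        = {#complex_of_real a, complex_of_real b, c, cnj c#}"
  proof -
    have "c + cnj c = of_real (\<kappa> * r)" "c * cnj c = of_real (r^2)"
      by (simp_all add: complex_eq_iff c_def assms(5) power2_eq_square algebra_simps flip: distrib_left)
    hence c: "[:-c, 1:] * [:-cnj c, 1:] = [:of_real (r^2), - of_real (\<kappa> * r), 1:]"
      by (simp add: algebra_simps)
    have "[:-complex_of_real a, 1:] * [:-complex_of_real b, 1:] = [:of_real P, - of_real S, 1:]"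
      by (simp flip: sum prod)
    hence "[:-complex_of_real a, 1:] * [:-complex_of_real b, 1:] * ([:-c, 1:] * [:-cnj c, 1:])
        = [:of_real P, - of_real S, 1:] * [:of_real (r^2), - of_real (\<kappa> * r), 1:]"
      unfolding c by simp
    also have "\<dots> = [:of_real (r^2 * P), - of_real (\<kappa> * r * P + r^2 * S),
        of_real (r^2 + P + \<kappa> * r * S), - of_real (\<kappa> * r + S), 1:]"
      by (simp add: algebra_simps)
    also have "\<kappa> * r * P + r^2 * S = 1"
      using assms(7) by (simp add: assms(8,9) algebra_simps power2_eq_square power3_eq_cube)
    also have "r^2 + P + \<kappa> * r * S = 3"
      by (simp add: assms(8,9) algebra_simps power2_eq_square)
    also have "\<kappa> * r + S = 3" by (simp add: assms(8))
    finally have "[:complex_of_real (1 / z), -1, 3, -3, 1:] =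
        [:-complex_of_real a, 1:] * [:-complex_of_real b, 1:] * ([:-c, 1:] * [:-cnj c, 1:])"
      by (simp add: iz)
    also have "proots \<dots> = {#complex_of_real a, complex_of_real b, c, cnj c#}"
      by (simp only: proots_mult proots_linear_factor mult_eq_0_iff pCons_eq_0_iff one_neq_zero
          simp_thms) simp
    finally show ?thesis .
  qed
  moreover have "c = complex_of_real r * exp (\<i> * complex_of_real \<theta>)"
    by (simp add: c_def rcis_def cis_conv_exp)
  moreover have "cnj c = complex_of_real r * exp (- \<i> * complex_of_real \<theta>)"
    by (simp add: c_def rcis_def cis_conv_exp exp_cnj)
  moreover have "r = sin ((pi + \<theta>) / 3) / sin ((pi + 4 * \<theta>) / 3)" using r by (simp only: root_modulus_def)
  ultimately show ?thesis using z0 ab formula by metis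
qed

end
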